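(* Let $\mathbf{X}=A\mathbf{Z}$ be the linear factor model described in the context, in the nonnegative case (i.e. $Z_1,\dots,Z_p$ are i.i.d. nonnegative with $\mathbb{P}(Z_1>z)\sim cz^{-\alpha}$ as $z\to\infty$ for some $\alpha>0$, $c>0$). Let $(u_n)$ be a sequence of real numbers with $u_n\to\infty$ as $n\to\infty$. Then for every $j=1,\dots,p$, the conditional law of $$u_n\left(\frac{\mathbf{X}}{\|\mathbf{X}\|}-\mathbf{c}_j\right)$$ given $\|\mathbf{X}\|>u_n$ and $Z_j>u_n/w^{1/\alpha}$ converges weakly, as $n\to\infty$, to the law of $$\frac{1}{\|\mathbf{a}^{(j)}\|^{2}W_\alpha}\left(S^*_{1,-j},\ldots,S^*_{d,-j}\right)^\top,$$ where $W_\alpha$ is a Pareto random variable, $\mathbb{P}(W_\alpha>x)=x^{-\alpha}$ for $x\ge 1$, independent of $Z_1,\dots,Z_p$, and for $l=1,\dots,d$ $$S^*_{l,-j}=\sum_{i=1}^d\left(a_{ij}^2X_{l,-j}-a_{lj}a_{ij}X_{i,-j}\right),\qquad X_{i,-j}=X_i-a_{ij}Z_j=\sum_{\substack{m=1\\ m\neq j}}^p a_{im}Z_m .$$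
   Context: Linear factor model: $A=[a_{ij}]_{i=1,\dots,d;\,j=1,\dots,p}$ is a deterministic $d\times p$ matrix with nonnegative entries and nonzero columns; $\mathbf{Z}=(Z_1,\dots,Z_p)^\top$ has i.i.d. components with $\mathbb{P}(Z_1>z)\sim cz^{-\alpha}$ as $z\to\infty$ ($f\sim g$ means $f/g\to1$) for some $\alpha>0$, $c>0$; $\mathbf{X}=(X_1,\dots,X_d)^\top=A\mathbf{Z}$. The norm $\|\cdot\|$ is Euclidean. $\mathbf{a}^{(k)}=(a_{1k},\dots,a_{dk})^\top$ is the $k$-th column of $A$, $w=\sum_{k=1}^p\|\mathbf{a}^{(k)}\|^\alpha$, and $\mathbf{c}_k=\mathbf{a}^{(k)}/\|\mathbf{a}^{(k)}\|$ for $k=1,\dots,p$. *)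

theory Defs
  imports "HOL-Probability.Probability" "HOL-Library.Landau_Symbols"
begin

text \<open>
  The library's \<open>weak_conv_m\<close> is formulated with distribution functions and so covers only
  measures on the real line; this is the usual definition for Borel probability measures
  on a topological space.
\<close>

definition converges_weakly ::
  "(nat \<Rightarrow> 'a::topological_space measure) \<Rightarrow> 'a measure \<Rightarrow> bool" where
  "converges_weakly \<mu>s \<mu> \<longleftrightarrow>
     (\<forall>f :: 'a \<Rightarrow> real. continuous_on UNIV f \<and> bounded (range f) \<longrightarrow>
        (\<lambda>n. integral\<^sup>L (\<mu>s n) f) \<longlonglongrightarrow> integral\<^sup>L \<mu> f)"

text \<open>The law of \<open>Y\<close> given the event \<open>E\<close>, meaningful when \<open>E\<close> has positive probability.\<close>

definition cond_law ::
  "'a measure \<Rightarrow> 'a set \<Rightarrow> ('a \<Rightarrow> 'b::topological_space) \<Rightarrow> 'b measure" where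
  "cond_law M E Y = distr (uniform_measure M E) borel Y"

text \<open>
  Independence of two random elements through the \<open>\<sigma>\<close>-algebras they generate; the library's
  \<open>indep_var\<close> requires both to take values in the same type.
\<close>

definition independent_rvs ::
  "'a measure \<Rightarrow> ('a \<Rightarrow> 'b::topological_space) \<Rightarrow> ('a \<Rightarrow> 'c::topological_space) \<Rightarrow> bool" where
  "independent_rvs M U V \<longleftrightarrow>
     U \<in> borel_measurable M \<and> V \<in> borel_measurable M \<and>
     prob_space.indep_set M
       (sets (vimage_algebra (space M) U borel)) (sets (vimage_algebra (space M) V borel))"

definition total_weight :: "real^'p^'d \<Rightarrow> real \<Rightarrow> real" where
  "total_weight A \<alpha> = (\<Sum>k\<in>UNIV. norm (column k A) powr \<alpha>)"

definition direction :: "real^'p^'d \<Rightarrow> 'p \<Rightarrow> real^'d" where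
  "direction A k = column k A /\<^sub>R norm (column k A)"

definition X_minus :: "real^'p^'d \<Rightarrow> 'p \<Rightarrow> real^'p \<Rightarrow> real^'d" where
  "X_minus A j z = (\<chi> i. (A *v z) $ i - A $ i $ j * z $ j)"

lemma X_minus_eq_sum:
  "X_minus A j z $ i = (\<Sum>m\<in>UNIV - {j}. A $ i $ m * z $ m)"
  by (simp add: X_minus_def matrix_vector_mult_def sum_diff1)

definition S_star :: "real^'p^'d \<Rightarrow> 'p \<Rightarrow> real^'p \<Rightarrow> real^'d" where
  "S_star A j z =
     (\<chi> l. \<Sum>i\<in>UNIV. (A $ i $ j)\<^sup>2 * X_minus A j z $ l - A $ l $ j * A $ i $ j * X_minus A j z $ i)"

end

theory Submission imports Defs begin

text \<open>
  Put \<open>\<kappa> = w powr (1/\<alpha>)\<close>, \<open>v\<^sub>n = u\<^sub>n / \<kappa>\<close> and \<open>b = \<kappa> / \<parallel>a\<parallel> \<ge> 1\<close>, where \<open>a\<close> is the \<open>j\<close>-th column of \<open>A\<close>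
  and \<open>e\<close> its direction. Given \<open>Z\<^sub>j > v\<^sub>n\<close>, the ratio \<open>Z\<^sub>j / v\<^sub>n\<close> is asymptotically a Pareto variable \<open>W\<close>,
  while the remainder \<open>R = X - Z\<^sub>j a\<close> keeps its law and stays independent of it. Expanding the norm
  shows that on this event the rescaled deviation tends to \<open>(b/W) (R - \<langle>e, R\<rangle> e)\<close> and that
  \<open>\<parallel>X\<parallel> > u\<^sub>n\<close> becomes \<open>W > b\<close>. Since \<open>W / b\<close> given \<open>W > b\<close> is again Pareto, the factor \<open>b\<close> disappears
  when the limit is conditioned on \<open>W > b\<close>.
\<close>

section \<open>Conditioning\<close>

text \<open>Conditioning on \<open>E\<close> is a change of density by
  \<open>indicator E / prob E\<close>. This turns conditional expectations into quotients of
  integrals over the fixed measure \<open>M\<close>, whose limits can be taken separately.\<close>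

lemma (in prob_space) integral_uniform_measure:
  fixes f :: "'a \<Rightarrow> real"
  assumes E: "E \<in> sets M" and pos: "prob E > 0" and f: "f \<in> borel_measurable M"
  shows "integral\<^sup>L (uniform_measure M E) f = (\<integral>\<omega>. indicator E \<omega> * f \<omega> \<partial>M) / prob E"
proof -
  have "uniform_measure M E = density M (\<lambda>\<omega>. ennreal (indicator E \<omega> / prob E))"
    unfolding uniform_measure_def
    by (intro density_cong)
      (use E pos in \<open>auto simp: emeasure_eq_measure divide_ennreal[of 1, simplified] indicator_def\<close>)
  then have "integral\<^sup>L (uniform_measure M E) f = (\<integral>\<omega>. (indicator E \<omega> / prob E) *\<^sub>R f \<omega> \<partial>M)"
    by (simp only:) (rule integral_density, use E f in auto)
  also have "\<dots> = (\<integral>\<omega>. indicator E \<omega> * f \<omega> / prob E \<partial>M)"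
    by (rule Bochner_Integration.integral_cong) auto
  finally show ?thesis by simp
qed

text \<open>Rectangles determine a product of \<sigma>-finite measures. The product rule enters as
  an identity of probabilities, the form in which both independence statements of the model are
  available.\<close>

lemma (in prob_space) distr_pair_eq_product:
  assumes U[measurable]: "U \<in> measurable M S" and V[measurable]: "V \<in> measurable M T"
    and prod: "\<And>A B. A \<in> sets S \<Longrightarrow> B \<in> sets T \<Longrightarrow>
      prob {\<omega> \<in> space M. U \<omega> \<in> A \<and> V \<omega> \<in> B} =
      prob {\<omega> \<in> space M. U \<omega> \<in> A} * prob {\<omega> \<in> space M. V \<omega> \<in> B}"
  shows "distr M (S \<Otimes>\<^sub>M T) (\<lambda>\<omega>. (U \<omega>, V \<omega>)) = distr M S U \<Otimes>\<^sub>M distr M T V"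
proof (rule pair_measure_eqI[symmetric])
  interpret U: prob_space "distr M S U" by (rule prob_space_distr) simp
  interpret V: prob_space "distr M T V" by (rule prob_space_distr) simp
  show "sigma_finite_measure (distr M S U)" "sigma_finite_measure (distr M T V)"
    by unfold_locales
  show "sets (distr M S U \<Otimes>\<^sub>M distr M T V) = sets (distr M (S \<Otimes>\<^sub>M T) (\<lambda>\<omega>. (U \<omega>, V \<omega>)))"
    by (simp cong: sets_pair_measure_cong)
  fix A B assume "A \<in> sets (distr M S U)" "B \<in> sets (distr M T V)"
  then have AB[measurable]: "A \<in> sets S" "B \<in> sets T" by auto
  have "U -` A \<inter> space M = {\<omega> \<in> space M. U \<omega> \<in> A}"
       "V -` B \<inter> space M = {\<omega> \<in> space M. V \<omega> \<in> B}"
       "(\<lambda>\<omega>. (U \<omega>, V \<omega>)) -` (A \<times> B) \<inter> space M = {\<omega> \<in> space M. U \<omega> \<in> A \<and> V \<omega> \<in> B}"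
    by auto
  then show "emeasure (distr M S U) A * emeasure (distr M T V) B =
      emeasure (distr M (S \<Otimes>\<^sub>M T) (\<lambda>\<omega>. (U \<omega>, V \<omega>))) (A \<times> B)"
    by (simp add: emeasure_distr emeasure_eq_measure prod[OF AB] ennreal_mult)
qed

text \<open>The conditioning event restricts \<open>U\<close> alone, so it is absorbed into the
  first side of each rectangle and leaves the law of \<open>V\<close> untouched. The map
  \<open>g\<close> leaves room for rescaling \<open>U\<close> by the threshold.\<close>

lemma (in prob_space) distr_pair_conditioned:
  assumes U[measurable]: "U \<in> measurable M S" and V[measurable]: "V \<in> measurable M T"
    and prod: "\<And>A B. A \<in> sets S \<Longrightarrow> B \<in> sets T \<Longrightarrow>
      prob {\<omega> \<in> space M. U \<omega> \<in> A \<and> V \<omega> \<in> B} =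
      prob {\<omega> \<in> space M. U \<omega> \<in> A} * prob {\<omega> \<in> space M. V \<omega> \<in> B}"
    and D[measurable]: "D \<in> sets S" and pos: "prob {\<omega> \<in> space M. U \<omega> \<in> D} > 0"
    and g[measurable]: "g \<in> measurable S S'"
  shows "distr (uniform_measure M {\<omega> \<in> space M. U \<omega> \<in> D}) (S' \<Otimes>\<^sub>M T) (\<lambda>\<omega>. (g (U \<omega>), V \<omega>)) =
    distr (uniform_measure M {\<omega> \<in> space M. U \<omega> \<in> D}) S' (\<lambda>\<omega>. g (U \<omega>)) \<Otimes>\<^sub>M distr M T V"
proof -
  let ?G = "{\<omega> \<in> space M. U \<omega> \<in> D}"
  let ?N = "uniform_measure M ?G"
  have G: "?G \<in> sets M" "emeasure M ?G \<noteq> 0" "emeasure M ?G \<noteq> \<infinity>"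
    using pos by (auto simp: emeasure_eq_measure)
  interpret N: prob_space ?N by (rule prob_space_uniform_measure[OF G(2,3)])
  have N: "N.prob C = prob (?G \<inter> C) / prob ?G" if "C \<in> sets M" for C
    using G that by simp
  have joint: "N.prob {\<omega> \<in> space M. U \<omega> \<in> A \<and> V \<omega> \<in> B} =
      prob {\<omega> \<in> space M. U \<omega> \<in> D \<inter> A} * prob {\<omega> \<in> space M. V \<omega> \<in> B} / prob ?G"
    if [measurable]: "A \<in> sets S" "B \<in> sets T" for A B
  proof -
    have "?G \<inter> {\<omega> \<in> space M. U \<omega> \<in> A \<and> V \<omega> \<in> B} = {\<omega> \<in> space M. U \<omega> \<in> D \<inter> A \<and> V \<omega> \<in> B}"
      by auto
    then show ?thesis
      using prod[of "D \<inter> A" B] by (subst N) simp_all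
  qed
  have left: "N.prob {\<omega> \<in> space M. U \<omega> \<in> A} = prob {\<omega> \<in> space M. U \<omega> \<in> D \<inter> A} / prob ?G"
    if [measurable]: "A \<in> sets S" for A
    by (subst N) (auto intro!: arg_cong[where f = prob] simp: Int_def)
  have right: "N.prob {\<omega> \<in> space M. V \<omega> \<in> B} = prob {\<omega> \<in> space M. V \<omega> \<in> B}"
    if [measurable]: "B \<in> sets T" for B
  proof -
    have "?G \<inter> {\<omega> \<in> space M. V \<omega> \<in> B} = {\<omega> \<in> space M. U \<omega> \<in> D \<and> V \<omega> \<in> B}"
      by auto
    then show ?thesis
      \<comment> \<open>The product rule with first side \<open>D\<close> produces a factor
        \<open>prob ?G\<close>, which cancels the normalisation.\<close>
      using prod[of D B] pos by (subst N) simp_all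
  qed
  have "distr ?N (S' \<Otimes>\<^sub>M T) (\<lambda>\<omega>. (g (U \<omega>), V \<omega>)) = distr ?N S' (\<lambda>\<omega>. g (U \<omega>)) \<Otimes>\<^sub>M distr ?N T V"
  proof (rule N.distr_pair_eq_product)
    fix A B assume A[measurable]: "A \<in> sets S'" and B[measurable]: "B \<in> sets T"
    \<comment> \<open>Pulling \<open>A\<close> back along \<open>g\<close> turns events on
      \<open>g (U \<omega>)\<close> into events on \<open>U \<omega>\<close>, to which the three
      formulas above apply.\<close>
    let ?A = "g -` A \<inter> space S"
    have A': "?A \<in> sets S" by measurable
    have "g (U \<omega>) \<in> A \<longleftrightarrow> U \<omega> \<in> ?A" if "\<omega> \<in> space M" for \<omega>
      using measurable_space[OF U that] by auto
    then have eq: "{\<omega> \<in> space M. g (U \<omega>) \<in> A \<and> V \<omega> \<in> B} = {\<omega> \<in> space M. U \<omega> \<in> ?A \<and> V \<omega> \<in> B}"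
        "{\<omega> \<in> space M. g (U \<omega>) \<in> A} = {\<omega> \<in> space M. U \<omega> \<in> ?A}"
      by blast+
    show "N.prob {\<omega> \<in> space ?N. g (U \<omega>) \<in> A \<and> V \<omega> \<in> B} =
        N.prob {\<omega> \<in> space ?N. g (U \<omega>) \<in> A} * N.prob {\<omega> \<in> space ?N. V \<omega> \<in> B}"
      unfolding space_uniform_measure eq
      by (simp only: joint[OF A' B] left[OF A'] right[OF B]) simp
  qed simp_all
  also have "distr ?N T V = distr M T V"
  proof (rule measure_eqI)
    fix B assume "B \<in> sets (distr ?N T V)"
    then have B: "B \<in> sets T" by simp
    have "V -` B \<inter> space M = {\<omega> \<in> space M. V \<omega> \<in> B}" by auto
    then show "emeasure (distr ?N T V) B = emeasure (distr M T V) B"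
      using right[OF B] B
      by (simp add: emeasure_distr emeasure_eq_measure N.emeasure_eq_measure del: emeasure_uniform_measure measure_uniform_measure)
  qed simp
  finally show ?thesis .
qed

section \<open>Weak convergence along an independent coordinate\<close>

text \<open>Skorohod's theorem replaces the first coordinate by an almost surely convergent one, after
  which dominated convergence on the product space applies.\<close>

lemma integral_pair_tendsto:
  fixes \<mu> :: "nat \<Rightarrow> real measure" and h :: "nat \<Rightarrow> real \<times> 'b \<Rightarrow> real"
  assumes \<mu>: "\<And>n. real_distribution (\<mu> n)" and P: "real_distribution P"
    and conv: "weak_conv_m \<mu> P" and Q: "prob_space Q"
    and h[measurable]: "\<And>n. h n \<in> borel_measurable (borel \<Otimes>\<^sub>M Q)"
    and h0[measurable]: "h0 \<in> borel_measurable (borel \<Otimes>\<^sub>M Q)"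
    and bound: "\<And>n x. \<bar>h n x\<bar> \<le> B"
    and lim: "AE t in P. \<forall>y\<in>space Q. \<forall>\<tau>. \<tau> \<longlonglongrightarrow> t \<longrightarrow> (\<lambda>n. h n (\<tau> n, y)) \<longlonglongrightarrow> h0 (t, y)"
  shows "(\<lambda>n. integral\<^sup>L (\<mu> n \<Otimes>\<^sub>M Q) (h n)) \<longlonglongrightarrow> integral\<^sup>L (P \<Otimes>\<^sub>M Q) h0"
proof -
  obtain \<Omega> :: "real measure" and Ys :: "nat \<Rightarrow> real \<Rightarrow> real" and Y :: "real \<Rightarrow> real"
    where \<Omega>: "prob_space \<Omega>" and Ys[measurable]: "\<And>n. Ys n \<in> borel_measurable \<Omega>"
      and dYs: "\<And>n. distr \<Omega> borel (Ys n) = \<mu> n" and Y': "Y \<in> measurable \<Omega> lborel"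
      and dY: "distr \<Omega> borel Y = P" and Y_lim: "\<And>x. x \<in> space \<Omega> \<Longrightarrow> (\<lambda>n. Ys n x) \<longlonglongrightarrow> Y x"
    using Skorohod[OF \<mu> P conv] by blast
  have Y[measurable]: "Y \<in> borel_measurable \<Omega>" using Y' by simp
  interpret \<Omega>: prob_space \<Omega> by fact
  interpret Q: prob_space Q by fact
  interpret pair_prob_space \<Omega> Q ..
  \<comment> \<open>Integrals over a law times \<open>Q\<close> are pulled back to
    \<open>\<Omega>\<close> times \<open>Q\<close>, the second factor being mapped by the identity.
    All \<open>n\<close> then share one product space.\<close>
  have transfer: "integral\<^sup>L (distr \<Omega> borel U \<Otimes>\<^sub>M Q) k = (\<integral>x. k (U (fst x), snd x) \<partial>(\<Omega> \<Otimes>\<^sub>M Q))"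
    if [measurable]: "U \<in> borel_measurable \<Omega>" "k \<in> borel_measurable (borel \<Otimes>\<^sub>M Q)"
    for U :: "real \<Rightarrow> real" and k :: "real \<times> 'b \<Rightarrow> real"
  proof -
    have "distr \<Omega> borel U \<Otimes>\<^sub>M distr Q Q (\<lambda>y. y) = distr (\<Omega> \<Otimes>\<^sub>M Q) (borel \<Otimes>\<^sub>M Q) (\<lambda>(x, y). (U x, y))"
      by (rule pair_measure_distr) (simp_all add: distr_id[unfolded id_def] Q.sigma_finite_measure_axioms)
    then have *: "distr \<Omega> borel U \<Otimes>\<^sub>M Q = distr (\<Omega> \<Otimes>\<^sub>M Q) (borel \<Otimes>\<^sub>M Q) (\<lambda>(x, y). (U x, y))"
      by (simp add: distr_id[unfolded id_def])
    show ?thesis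
      unfolding * by (subst integral_distr) (auto simp: case_prod_beta)
  qed
  obtain N where N: "N \<in> null_sets P"
    and N_lim: "\<And>t y \<tau>. t \<notin> N \<Longrightarrow> t \<in> space P \<Longrightarrow> y \<in> space Q \<Longrightarrow> \<tau> \<longlonglongrightarrow> t \<Longrightarrow>
      (\<lambda>n. h n (\<tau> n, y)) \<longlonglongrightarrow> h0 (t, y)"
    using lim by (auto elim!: AE_E3)
  have [simp]: "space P = UNIV"
    using real_distribution.events_eq_borel[OF P] by (metis sets_eq_imp_space_eq space_borel)
  \<comment> \<open>The exceptional set \<open>N\<close> restricts only the first coordinate,
    uniformly in \<open>y\<close> and \<open>\<tau>\<close>. Hence its preimage under
    \<open>Y\<close>, times the whole of \<open>Q\<close>, is null in the product.\<close>
  have "Y -` N \<inter> space \<Omega> \<in> null_sets \<Omega>"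
    using N unfolding dY[symmetric] by (subst (asm) null_sets_distr_iff) auto
  then have "(Y -` N \<inter> space \<Omega>) \<times> space Q \<in> null_sets (\<Omega> \<Otimes>\<^sub>M Q)"
    by (rule Q.times_in_null_sets1) simp
  then have ae: "AE x in \<Omega> \<Otimes>\<^sub>M Q. (\<lambda>n. h n (Ys n (fst x), snd x)) \<longlonglongrightarrow> h0 (Y (fst x), snd x)"
  proof (rule AE_I')
    have "Y x \<in> N"
      if "x \<in> space \<Omega>" "y \<in> space Q" "\<not> (\<lambda>n. h n (Ys n x, y)) \<longlonglongrightarrow> h0 (Y x, y)" for x y
      using N_lim[OF _ _ that(2) Y_lim[OF that(1)]] that(3) by auto
    then show "{x \<in> space (\<Omega> \<Otimes>\<^sub>M Q). \<not> (\<lambda>n. h n (Ys n (fst x), snd x)) \<longlonglongrightarrow> h0 (Y (fst x), snd x)}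
        \<subseteq> (Y -` N \<inter> space \<Omega>) \<times> space Q"
      by (auto simp: space_pair_measure)
  qed
  have "(\<lambda>n. \<integral>x. h n (Ys n (fst x), snd x) \<partial>(\<Omega> \<Otimes>\<^sub>M Q)) \<longlonglongrightarrow>
      (\<integral>x. h0 (Y (fst x), snd x) \<partial>(\<Omega> \<Otimes>\<^sub>M Q))"
    by (rule integral_dominated_convergence[where w = "\<lambda>_. B"]) (use ae bound in auto)
  then show ?thesis
    by (simp add: transfer flip: dYs dY)
qed

section \<open>Pareto laws\<close>

lemma (in real_distribution) cdf_eq_tail: "cdf M x = 1 - prob {x<..}"
proof -
  have "{..x} = space M - {x<..}" by auto
  then show ?thesis
    unfolding cdf_def by (simp only: prob_compl) (simp add: prob_compl del: space_eq_univ)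
qed

text \<open>The tail equals one at the point 1, so the distribution function vanishes there and, by
  monotonicity, to the left. The form with \<open>max 1 x\<close> makes continuity everywhere
  visible.\<close>

lemma (in real_distribution) pareto_cdf:
  assumes tail: "\<And>x. x \<ge> 1 \<Longrightarrow> prob {x<..} = x powr (-\<alpha>)"
  shows "cdf M x = 1 - max 1 x powr (-\<alpha>)"
proof (cases "x \<ge> 1")
  case True
  then show ?thesis by (simp add: cdf_eq_tail tail max_def)
next
  case False
  have "cdf M x \<le> cdf M 1"
    using False by (intro finite_borel_measure.cdf_nondecreasing finite_borel_measure_M) auto
  also have "cdf M 1 = 0" by (simp add: cdf_eq_tail tail)
  finally have "cdf M x \<le> 0" .
  moreover have "cdf M x \<ge> 0" by (simp add: cdf_def)
  ultimately show ?thesis using False by (simp add: max_def)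
qed

text \<open>A continuous distribution function has no atoms. The point \<open>b\<close> will be the
  jump of the limiting indicator and must be avoided almost surely.\<close>

lemma (in real_distribution) pareto_AE:
  assumes tail: "\<And>x. x \<ge> 1 \<Longrightarrow> prob {x<..} = x powr (-\<alpha>)"
  shows "AE t in M. t > 1 \<and> t \<noteq> b"
proof -
  have "isCont (\<lambda>x. 1 - max 1 x powr (-\<alpha>)) b"
    by (intro continuous_intros) auto
  then have "isCont (cdf M) b"
    by (subst ext[of "cdf M" "\<lambda>x. 1 - max 1 x powr (-\<alpha>)", OF pareto_cdf[OF tail]])
  then have "prob {b} = 0"
    using finite_borel_measure.isCont_cdf[OF finite_borel_measure_M] by auto
  then have "AE t in M. t \<notin> {b}"
    by (intro AE_not_in) (auto simp: null_sets_def emeasure_eq_measure)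
  moreover have "AE t in M. t \<in> {1<..}"
    by (rule AE_prob_1) (simp add: tail)
  ultimately show ?thesis by eventually_elim auto
qed

text \<open>For \<open>x \<ge> 1\<close> the conditional tail is
  \<open>(b * x) powr (-\<alpha>) / b powr (-\<alpha>)\<close>, in which \<open>b\<close> cancels;
  the distribution function then determines the law.\<close>

lemma (in real_distribution) pareto_rescale:
  assumes tail: "\<And>x. x \<ge> 1 \<Longrightarrow> prob {x<..} = x powr (-\<alpha>)" and b: "b \<ge> 1"
  shows "distr (uniform_measure M {b<..}) borel (\<lambda>x. x / b) = M"
proof -
  let ?U = "uniform_measure M {b<..}"
  have pos: "emeasure M {b<..} \<noteq> 0" "emeasure M {b<..} \<noteq> \<infinity>"
    using b by (auto simp: emeasure_eq_measure tail)
  interpret U: prob_space ?U by (rule prob_space_uniform_measure[OF pos])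
  interpret D: real_distribution "distr ?U borel (\<lambda>x. x / b)"
    by (rule U.real_distribution_distr) simp
  have "D.prob {x<..} = x powr (-\<alpha>)" if x: "x \<ge> 1" for x
  proof -
    have "(\<lambda>x. x / b) -` {x<..} = {b * x<..}"
      using b by (auto simp: field_simps)
    moreover have "b \<le> b * x"
      using b x mult_left_mono[of 1 x b] by simp
    then have "{b<..} \<inter> {b * x<..} = {b * x<..}"
      by auto
    moreover have "b * x \<ge> 1"
      using b x mult_mono[of 1 b 1 x] by auto
    ultimately have "D.prob {x<..} = (b * x) powr (-\<alpha>) / b powr (-\<alpha>)"
      using pos b by (simp add: measure_distr tail)
    then show ?thesis
      using b x by (simp add: powr_mult)
  qed
  then have "cdf (distr ?U borel (\<lambda>x. x / b)) = cdf M"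
    by (intro ext) (simp add: D.pareto_cdf pareto_cdf[OF tail])
  then show ?thesis
    by (rule cdf_unique[OF D.real_distribution_axioms real_distribution_axioms])
qed

lemma (in real_distribution) pareto_integral_rescale:
  fixes g :: "real \<Rightarrow> real"
  assumes tail: "\<And>x. x \<ge> 1 \<Longrightarrow> prob {x<..} = x powr (-\<alpha>)" and b: "b \<ge> 1"
    and g[measurable]: "g \<in> borel_measurable borel"
  shows "(\<integral>x. indicator {b<..} x * g (x / b) \<partial>M) = b powr (-\<alpha>) * integral\<^sup>L M g"
proof -
  have "integral\<^sup>L M g = integral\<^sup>L (distr (uniform_measure M {b<..}) borel (\<lambda>x. x / b)) g"
    by (simp add: pareto_rescale[OF tail b])
  also have "\<dots> = (\<integral>x. g (x / b) \<partial>uniform_measure M {b<..})"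
    by (subst integral_distr) auto
  also have "\<dots> = (\<integral>x. indicator {b<..} x * g (x / b) \<partial>M) / prob {b<..}"
    using b by (intro integral_uniform_measure) (auto simp: tail)
  finally show ?thesis
    using b by (simp add: tail)
qed

text \<open>Comparing numerator and denominator with the power function leaves two quotients tending
  to 1 and the exact ratio \<open>x powr (-\<alpha>)\<close>.\<close>

lemma powr_tail_ratio:
  fixes F :: "real \<Rightarrow> real"
  assumes F: "F \<sim>[at_top] (\<lambda>z. c * z powr (-\<alpha>))" and c: "c > 0" and x: "x > 0"
    and v: "filterlim v at_top sequentially"
  shows "(\<lambda>n. F (x * v n) / F (v n)) \<longlonglongrightarrow> x powr (-\<alpha>)"
proof -
  have lim: "(\<lambda>n. F (w n) / (c * w n powr (-\<alpha>))) \<longlonglongrightarrow> 1"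
    if w: "filterlim w at_top sequentially" for w
  proof -
    \<comment> \<open>Asymptotic equivalence is a limit of quotients with 0/0 read as 1. For
      \<open>w n > 0\<close> the power function is positive, so this exception eventually
      disappears.\<close>
    have "(\<lambda>n. if F (w n) = 0 \<and> c * w n powr (-\<alpha>) = 0 then 1 else F (w n) / (c * w n powr (-\<alpha>))) \<longlonglongrightarrow> 1"
      using filterlim_compose[OF asymp_equivD[OF F] w] .
    moreover have "eventually (\<lambda>n. w n > 0) sequentially"
      using w by (simp add: filterlim_at_top_dense)
    then have "eventually (\<lambda>n. (if F (w n) = 0 \<and> c * w n powr (-\<alpha>) = 0 then 1
        else F (w n) / (c * w n powr (-\<alpha>))) = F (w n) / (c * w n powr (-\<alpha>))) sequentially"
      by eventually_elim (use c in auto)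
    ultimately show ?thesis
      by (rule Lim_transform_eventually)
  qed
  have xv: "filterlim (\<lambda>n. x * v n) at_top sequentially"
    using filterlim_tendsto_pos_mult_at_top[OF tendsto_const x v] .
  have "(\<lambda>n. x powr (-\<alpha>) * (F (x * v n) / (c * (x * v n) powr (-\<alpha>))) / (F (v n) / (c * v n powr (-\<alpha>))))
      \<longlonglongrightarrow> x powr (-\<alpha>) * 1 / 1"
    by (intro tendsto_intros lim xv v) auto
  moreover have "eventually (\<lambda>n. v n > 0) sequentially"
    using v by (simp add: filterlim_at_top_dense)
  then have "eventually (\<lambda>n. x powr (-\<alpha>) * (F (x * v n) / (c * (x * v n) powr (-\<alpha>))) /
      (F (v n) / (c * v n powr (-\<alpha>))) = F (x * v n) / F (v n)) sequentially"
    by eventually_elim (use x c in \<open>auto simp: powr_mult\<close>)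
  ultimately show ?thesis
    unfolding mult_1_right div_by_1 by (rule Lim_transform_eventually)
qed

text \<open>The tail is eventually nonzero because the power function is, and it decreases in
  \<open>z\<close>; a nonzero value beyond \<open>z\<close> therefore bounds the value at
  \<open>z\<close> from below.\<close>

lemma (in prob_space) tail_pos:
  assumes [measurable]: "U \<in> borel_measurable M"
    and tail: "(\<lambda>z. prob {\<omega> \<in> space M. U \<omega> > z}) \<sim>[at_top] (\<lambda>z. c * z powr (-\<alpha>))" and c: "c > 0"
  shows "prob {\<omega> \<in> space M. U \<omega> > z} > 0"
proof -
  have "eventually (\<lambda>y. prob {\<omega> \<in> space M. U \<omega> > y} = 0 \<longleftrightarrow> c * y powr (-\<alpha>) = 0) at_top"
    by (rule asymp_equiv_eventually_zeros[OF tail])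
  then have "eventually (\<lambda>y. prob {\<omega> \<in> space M. U \<omega> > y} \<noteq> 0 \<and> y \<ge> z) at_top"
    using eventually_gt_at_top[of 0] eventually_ge_at_top[of z] by eventually_elim (use c in auto)
  then obtain y where y: "prob {\<omega> \<in> space M. U \<omega> > y} \<noteq> 0" "y \<ge> z"
    by (auto simp: eventually_at_top_linorder)
  have "0 < prob {\<omega> \<in> space M. U \<omega> > y}"
    using y(1) by (simp add: less_le)
  also have "\<dots> \<le> prob {\<omega> \<in> space M. U \<omega> > z}"
    using y(2) by (intro finite_measure_mono) auto
  finally show ?thesis .
qed

text \<open>Once \<open>v n > 0\<close>, the conditional distribution function at \<open>x\<close>
  is exactly one minus the tail ratio of \<open>max 1 x * v n\<close> and \<open>v n\<close>, so
  regular variation gives its limit.\<close>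

lemma (in prob_space) excess_weak_conv_pareto:
  assumes U[measurable]: "U \<in> borel_measurable M"
    and tail: "(\<lambda>z. prob {\<omega> \<in> space M. U \<omega> > z}) \<sim>[at_top] (\<lambda>z. c * z powr (-\<alpha>))" and c: "c > 0"
    and v: "filterlim v at_top sequentially"
    and P: "real_distribution P" and P_tail: "\<And>x. x \<ge> 1 \<Longrightarrow> measure P {x<..} = x powr (-\<alpha>)"
  shows "weak_conv_m
    (\<lambda>n. distr (uniform_measure M {\<omega> \<in> space M. U \<omega> > v n}) borel (\<lambda>\<omega>. U \<omega> / v n)) P"
  unfolding weak_conv_m_def weak_conv_def
proof (intro allI impI)
  fix x :: real
  let ?F = "\<lambda>z. prob {\<omega> \<in> space M. U \<omega> > z}"
  let ?\<mu> = "\<lambda>n. distr (uniform_measure M {\<omega> \<in> space M. U \<omega> > v n}) borel (\<lambda>\<omega>. U \<omega> / v n)"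
  have pos: "?F z > 0" for z by (rule tail_pos[OF U tail c])
  have "(\<lambda>n. 1 - ?F (max 1 x * v n) / ?F (v n)) \<longlonglongrightarrow> 1 - max 1 x powr (-\<alpha>)"
    by (intro tendsto_intros powr_tail_ratio[OF tail c _ v]) auto
  moreover have "eventually (\<lambda>n. 1 - ?F (max 1 x * v n) / ?F (v n) = cdf (?\<mu> n) x) sequentially"
  proof -
    have "eventually (\<lambda>n. v n > 0) sequentially"
      using v by (simp add: filterlim_at_top_dense)
    then show ?thesis
    proof eventually_elim
      case (elim n)
      let ?G = "{\<omega> \<in> space M. U \<omega> > v n}"
      have vle: "v n \<le> max 1 x * v n"
        using elim mult_right_mono[of 1 "max 1 x" "v n"] by simp
      \<comment> \<open>For \<open>x < 1\<close> both sides are false: exceeding \<open>v n\<close>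
        forces the ratio above 1.\<close>
      have "v n < U \<omega> \<and> U \<omega> / v n \<le> x \<longleftrightarrow> v n < U \<omega> \<and> \<not> max 1 x * v n < U \<omega>" for \<omega>
      proof -
        have "U \<omega> \<le> v n" if "\<not> 1 \<le> x" "U \<omega> \<le> x * v n"
          using that elim mult_right_mono[of x 1 "v n"] by linarith
        then show ?thesis
          using elim by (auto simp: pos_divide_le_eq max_def dest: leD)
      qed
      then have "?G \<inter> ((\<lambda>\<omega>. U \<omega> / v n) -` {..x} \<inter> space M) = ?G - {\<omega> \<in> space M. U \<omega> > max 1 x * v n}"
        by blast
      moreover have "prob (?G - {\<omega> \<in> space M. U \<omega> > max 1 x * v n}) = ?F (v n) - ?F (max 1 x * v n)"
        using vle by (intro finite_measure_Diff) auto
      ultimately have "cdf (?\<mu> n) x = (?F (v n) - ?F (max 1 x * v n)) / ?F (v n)"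
        using pos[of "v n"]
        by (simp add: cdf_def measure_distr emeasure_eq_measure)
      then show ?case
        using pos[of "v n"] by (simp add: diff_divide_distrib)
    qed
  qed
  ultimately have "(\<lambda>n. cdf (?\<mu> n) x) \<longlonglongrightarrow> 1 - max 1 x powr (-\<alpha>)"
    by (rule Lim_transform_eventually)
  then show "(\<lambda>n. cdf (?\<mu> n) x) \<longlonglongrightarrow> cdf P x"
    by (simp add: real_distribution.pareto_cdf[OF P P_tail])
qed

section \<open>Perturbed directions\<close>

text \<open>With \<open>y n\<close> the norm of \<open>s n *\<^sub>R e + r\<close>, the rescaled
  deviation is \<open>(u n / y n) *\<^sub>R (r - (y n - s n) *\<^sub>R e)\<close>. It remains to see
  that \<open>y n - s n\<close> tends to \<open>e \<bullet> r\<close>.\<close>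

lemma tendsto_perturbed_direction:
  fixes e r :: "'b::real_inner"
  assumes e: "norm e = 1" and u: "filterlim u at_top sequentially"
    and s: "(\<lambda>n. s n / u n) \<longlonglongrightarrow> q" and q: "q > 0"
  shows "(\<lambda>n. norm (s n *\<^sub>R e + r) / u n) \<longlonglongrightarrow> q"
    and "(\<lambda>n. u n *\<^sub>R ((s n *\<^sub>R e + r) /\<^sub>R norm (s n *\<^sub>R e + r) - e)) \<longlonglongrightarrow> (1 / q) *\<^sub>R (r - (e \<bullet> r) *\<^sub>R e)"
proof -
  define y where "y n = norm (s n *\<^sub>R e + r)" for n
  have upos: "eventually (\<lambda>n. u n > 0) sequentially"
    using u by (simp add: filterlim_at_top_dense)
  have inv: "(\<lambda>n. 1 / u n) \<longlonglongrightarrow> 0"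
    using tendsto_inverse_0_at_top[OF u] by (simp add: divide_inverse)
  have "(\<lambda>n. norm ((s n / u n) *\<^sub>R e + (1 / u n) *\<^sub>R r)) \<longlonglongrightarrow> norm (q *\<^sub>R e + 0 *\<^sub>R r)"
    by (intro tendsto_intros s inv)
  moreover have "eventually (\<lambda>n. norm ((s n / u n) *\<^sub>R e + (1 / u n) *\<^sub>R r) = y n / u n) sequentially"
    using upos
  proof eventually_elim
    case (elim n)
    have "(s n / u n) *\<^sub>R e + (1 / u n) *\<^sub>R r = (1 / u n) *\<^sub>R (s n *\<^sub>R e + r)"
      by (simp add: scaleR_add_right)
    then show ?case using elim by (simp only: norm_scaleR y_def) simp
  qed
  ultimately have y: "(\<lambda>n. y n / u n) \<longlonglongrightarrow> q"
    using e q by (auto intro: Lim_transform_eventually)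
  then show "(\<lambda>n. norm (s n *\<^sub>R e + r) / u n) \<longlonglongrightarrow> q"
    by (simp add: y_def)
  \<comment> \<open>This is \<open>y n - s n\<close> rationalised: the difference of squares over
    the sum, both divided by \<open>u n\<close> so that each term has a limit.\<close>
  define d where "d n = (2 * (s n / u n) * (e \<bullet> r) + (1 / u n) * (r \<bullet> r)) / (y n / u n + s n / u n)" for n
  have "d \<longlonglongrightarrow> (2 * q * (e \<bullet> r) + 0 * (r \<bullet> r)) / (q + q)"
    unfolding d_def by (intro tendsto_intros s y inv) (use q in auto)
  then have d: "d \<longlonglongrightarrow> e \<bullet> r" using q by simp
  have "(\<lambda>n. (1 / (y n / u n)) *\<^sub>R (r - d n *\<^sub>R e)) \<longlonglongrightarrow> (1 / q) *\<^sub>R (r - (e \<bullet> r) *\<^sub>R e)"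
    by (intro tendsto_intros y d) (use q in auto)
  moreover have "eventually (\<lambda>n. (1 / (y n / u n)) *\<^sub>R (r - d n *\<^sub>R e) =
      u n *\<^sub>R ((s n *\<^sub>R e + r) /\<^sub>R norm (s n *\<^sub>R e + r) - e)) sequentially"
    using upos order_tendstoD(1)[OF y q] order_tendstoD(1)[OF s q]
  proof eventually_elim
    case (elim n)
    then have pos: "u n > 0" "y n > 0" "s n > 0"
      by (auto simp: zero_less_divide_iff)
    have "(y n)\<^sup>2 = (s n *\<^sub>R e + r) \<bullet> (s n *\<^sub>R e + r)"
      by (simp add: y_def power2_norm_eq_inner)
    also have "\<dots> = s n * s n * (e \<bullet> e) + 2 * s n * (e \<bullet> r) + r \<bullet> r"
      by (simp add: inner_add_left inner_add_right inner_commute algebra_simps)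
    also have "e \<bullet> e = 1"
      using e by (simp add: norm_eq_1)
    finally have "2 * s n * (e \<bullet> r) + r \<bullet> r = (y n - s n) * (y n + s n)"
      by (simp add: power2_eq_square algebra_simps)
    moreover have "d n = (2 * s n * (e \<bullet> r) + r \<bullet> r) / (y n + s n)"
    proof -
      have "2 * (s n / u n) * (e \<bullet> r) + (1 / u n) * (r \<bullet> r) = (2 * s n * (e \<bullet> r) + r \<bullet> r) / u n"
          "y n / u n + s n / u n = (y n + s n) / u n"
        by (simp_all add: add_divide_distrib)
      then show ?thesis unfolding d_def using pos by simp
    qed
    ultimately have d: "d n = y n - s n"
      using pos by simp
    have *: "r - d n *\<^sub>R e = (s n *\<^sub>R e + r) - y n *\<^sub>R e"
      by (simp add: d algebra_simps)
    show ?case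
      unfolding * using pos by (simp add: scaleR_diff_right divide_inverse mult.commute flip: y_def)
  qed
  ultimately show "(\<lambda>n. u n *\<^sub>R ((s n *\<^sub>R e + r) /\<^sub>R norm (s n *\<^sub>R e + r) - e)) \<longlonglongrightarrow>
      (1 / q) *\<^sub>R (r - (e \<bullet> r) *\<^sub>R e)"
    by (rule Lim_transform_eventually)
qed

section \<open>The linear factor model\<close>

lemma independent_rvs_prob:
  assumes "prob_space M" and ind: "independent_rvs M U V"
    and A: "A \<in> sets borel" and B: "B \<in> sets borel"
  shows "measure M {\<omega> \<in> space M. U \<omega> \<in> A \<and> V \<omega> \<in> B} =
    measure M {\<omega> \<in> space M. U \<omega> \<in> A} * measure M {\<omega> \<in> space M. V \<omega> \<in> B}"
proof -
  interpret prob_space M by fact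
  have "prob ((U -` A \<inter> space M) \<inter> (V -` B \<inter> space M)) =
      prob (U -` A \<inter> space M) * prob (V -` B \<inter> space M)"
    using ind unfolding independent_rvs_def
    by (intro indep_setD) (auto intro: in_vimage_algebra[OF A] in_vimage_algebra[OF B])
  moreover have "(U -` A \<inter> space M) \<inter> (V -` B \<inter> space M) = {\<omega> \<in> space M. U \<omega> \<in> A \<and> V \<omega> \<in> B}"
      "U -` A \<inter> space M = {\<omega> \<in> space M. U \<omega> \<in> A}" "V -` B \<inter> space M = {\<omega> \<in> space M. V \<omega> \<in> B}"
    by auto
  ultimately show ?thesis by simp
qed

section \<open>The remainder vector and \<open>S_star\<close>\<close>

lemma X_minus_eq: "X_minus A j z = A *v z - z $ j *\<^sub>R column j A"
  by (simp add: X_minus_def vec_eq_iff column_def mult.commute)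

lemma mult_vec_eq_column_plus_X_minus: "A *v z = z $ j *\<^sub>R column j A + X_minus A j z"
  by (simp add: X_minus_eq)

lemma borel_measurable_X_minus [measurable]: "X_minus A j \<in> borel_measurable borel"
proof (rule borel_measurable_continuous_onI)
  show "continuous_on UNIV (X_minus A j)"
    unfolding X_minus_eq[abs_def] by (intro continuous_intros)
qed

text \<open>Summing over \<open>i\<close> yields the squared norm and an inner product. Thus
  \<open>S_star\<close> is the squared column norm times the component of the remainder orthogonal
  to the column.\<close>

lemma S_star_eq:
  "S_star A j z = (norm (column j A))\<^sup>2 *\<^sub>R X_minus A j z - (column j A \<bullet> X_minus A j z) *\<^sub>R column j A"
proof (rule vec_eq_iff[THEN iffD2], rule allI)
  fix l
  have n: "(norm (column j A))\<^sup>2 = (\<Sum>i\<in>UNIV. (A $ i $ j)\<^sup>2)"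
    unfolding power2_norm_eq_inner by (simp add: inner_vec_def column_def power2_eq_square)
  show "S_star A j z $ l = ((norm (column j A))\<^sup>2 *\<^sub>R X_minus A j z -
      (column j A \<bullet> X_minus A j z) *\<^sub>R column j A) $ l"
    by (simp add: n S_star_def sum_subtractf sum_distrib_left sum_distrib_right inner_vec_def)
      (simp add: column_def mult_ac)
qed

text \<open>The squared norm cancels and the column is normalised to its direction. At
  \<open>t = 0\<close> both sides vanish since division by zero gives zero, so the identity holds
  pointwise for any value of \<open>W\<close>.\<close>

lemma scaled_S_star_eq:
  "(1 / ((norm (column j A))\<^sup>2 * t)) *\<^sub>R S_star A j z =
    (1 / t) *\<^sub>R (X_minus A j z - (direction A j \<bullet> X_minus A j z) *\<^sub>R direction A j)"
  if "column j A \<noteq> 0"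
proof -
  define m where "m = norm (column j A)"
  have "m \<noteq> 0" using that by (simp add: m_def)
  then have "1 / (m\<^sup>2 * t) * m\<^sup>2 = 1 / t"
      "1 / (m\<^sup>2 * t) * y = 1 / t * (inverse m * y * inverse m)" for y
    by (simp_all add: power2_eq_square field_simps)
  then show ?thesis
    by (simp only: S_star_eq direction_def scaleR_diff_right scaleR_scaleR inner_scaleR_left flip: m_def)
qed

text \<open>The remainder is a measurable function of the coordinates other than \<open>j\<close>,
  and families of independent variables over disjoint index sets are independent.\<close>

lemma (in prob_space) factor_indep_X_minus:
  fixes Z :: "'a \<Rightarrow> real^'p" and A :: "real^'p^'d"
  assumes ind: "indep_vars (\<lambda>_. borel) (\<lambda>k \<omega>. Z \<omega> $ k) UNIV"
    and B: "B \<in> sets borel" and C: "C \<in> sets borel"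
  shows "prob {\<omega> \<in> space M. Z \<omega> $ j \<in> B \<and> X_minus A j (Z \<omega>) \<in> C} =
    prob {\<omega> \<in> space M. Z \<omega> $ j \<in> B} * prob {\<omega> \<in> space M. X_minus A j (Z \<omega>) \<in> C}"
proof -
  let ?R = "\<lambda>f. (\<chi> i. \<Sum>m\<in>UNIV - {j}. A $ i $ m * f m) :: real^'d"
  let ?PB = "PiM {j} (\<lambda>_. borel :: real measure)" and ?PC = "PiM (UNIV - {j}) (\<lambda>_. borel :: real measure)"
  have R: "?R \<in> borel_measurable ?PC"
  proof (subst borel_measurable_euclidean_space, rule ballI)
    fix y :: "real^'d" assume "y \<in> Basis"
    then obtain i where y: "y = axis i 1" by (auto simp: Basis_vec_def)
    have "(\<lambda>f. \<Sum>m\<in>UNIV - {j}. A $ i $ m * f m) \<in> borel_measurable ?PC"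
      by (intro borel_measurable_sum borel_measurable_times borel_measurable_const
          measurable_component_singleton)
    then show "(\<lambda>f. ?R f \<bullet> y) \<in> borel_measurable ?PC"
      unfolding y inner_axis by simp
  qed
  have indep: "indep_var ?PB (\<lambda>\<omega>. restrict (\<lambda>k. Z \<omega> $ k) {j}) ?PC (\<lambda>\<omega>. restrict (\<lambda>k. Z \<omega> $ k) (UNIV - {j}))"
    by (rule indep_var_restrict[OF ind]) auto
  have B': "(\<lambda>f. f j) -` B \<inter> space ?PB \<in> sets ?PB"
    using B by (intro measurable_sets[OF measurable_component_singleton]) auto
  have C': "?R -` C \<inter> space ?PC \<in> sets ?PC"
    by (rule measurable_sets[OF R C])
  have RX: "?R (\<lambda>k. Z \<omega> $ k) = X_minus A j (Z \<omega>)" for \<omega>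
    by (simp add: vec_eq_iff X_minus_eq_sum)
  show ?thesis
    using indep_varD[OF indep B' C']
    by (simp add: vimage_def Int_def RX space_PiM conj_commute)
qed

lemma bounded_range_abs_le:
  fixes f :: "'b \<Rightarrow> real"
  assumes "bounded (range f)"
  obtains B where "\<And>x. \<bar>f x\<bar> \<le> B" "B \<ge> 0"
proof -
  obtain B where B: "\<And>x. \<bar>f x\<bar> \<le> B"
    using assms by (auto simp: bounded_iff)
  moreover have "B \<ge> 0" using B[of undefined] by linarith
  ultimately show ?thesis by (rule that)
qed

text \<open>One nonnegative summand is at most the sum. This yields \<open>b \<ge> 1\<close>, which
  places \<open>b\<close> where the Pareto tail formula holds.\<close>

lemma norm_column_le_total_weight:
  assumes "\<alpha> > 0"
  shows "norm (column j A) \<le> total_weight A \<alpha> powr (1 / \<alpha>)"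
proof -
  have "norm (column j A) powr \<alpha> \<le> total_weight A \<alpha>"
    unfolding total_weight_def by (rule member_le_sum) auto
  then have "(norm (column j A) powr \<alpha>) powr (1 / \<alpha>) \<le> total_weight A \<alpha> powr (1 / \<alpha>)"
    using assms by (intro powr_mono2) auto
  then show ?thesis
    using assms by (simp add: powr_powr)
qed

theorem theorem4p1:
  fixes M :: "'a measure"
    and A :: "real^'p^'d"
    and Z :: "'a \<Rightarrow> real^'p"
    and X :: "'a \<Rightarrow> real^'d"
    and W :: "'a \<Rightarrow> real"
    and \<alpha> c :: real
    and u :: "nat \<Rightarrow> real"
    and j :: 'p
  assumes "prob_space M"
    and A_nonneg: "\<And>i k. A $ i $ k \<ge> 0"
    and A_columns: "\<And>k. column k A \<noteq> 0"
    and "\<alpha> > 0" and "c > 0"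
    and Z_indep: "prob_space.indep_vars M (\<lambda>_. borel) (\<lambda>k \<omega>. Z \<omega> $ k) UNIV"
    and Z_ident: "\<And>k l. distr M borel (\<lambda>\<omega>. Z \<omega> $ k) = distr M borel (\<lambda>\<omega>. Z \<omega> $ l)"
    and Z_nonneg: "\<And>k. AE \<omega> in M. Z \<omega> $ k \<ge> 0"
    and Z_tail: "\<And>k. (\<lambda>z. measure M {\<omega> \<in> space M. Z \<omega> $ k > z}) \<sim>[at_top] (\<lambda>z. c * z powr (-\<alpha>))"
    and X_def: "\<And>\<omega>. X \<omega> = A *v Z \<omega>"
    and W_indep: "independent_rvs M W Z"
    and W_pareto: "\<And>x. x \<ge> 1 \<Longrightarrow> measure M {\<omega> \<in> space M. W \<omega> > x} = x powr (-\<alpha>)"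
    and u_lim: "filterlim u at_top sequentially"
  shows "converges_weakly
    (\<lambda>n. cond_law M
           {\<omega> \<in> space M. norm (X \<omega>) > u n \<and> Z \<omega> $ j > u n / total_weight A \<alpha> powr (1 / \<alpha>)}
           (\<lambda>\<omega>. u n *\<^sub>R (X \<omega> /\<^sub>R norm (X \<omega>) - direction A j)))
    (distr M borel (\<lambda>\<omega>. (1 / ((norm (column j A))\<^sup>2 * W \<omega>)) *\<^sub>R S_star A j (Z \<omega>)))"
  (is "converges_weakly ?\<mu> ?\<nu>")
proof -
  interpret prob_space M by fact

  \<comment> \<open>Notation and measurability\<close>
  define \<kappa> where "\<kappa> = total_weight A \<alpha> powr (1 / \<alpha>)"
  define a where "a = column j A"
  define e where "e = direction A j"
  define b where "b = \<kappa> / norm a"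
  define v where "v n = u n / \<kappa>" for n
  \<comment> \<open>The event \<open>E n\<close> of the theorem lies in \<open>G n\<close>.
    Conditioning on \<open>G n\<close> comes first because it involves \<open>Z $ j\<close> alone
    and so preserves independence from \<open>R\<close>.\<close>
  define G where "G n = {\<omega> \<in> space M. Z \<omega> $ j > v n}" for n
  define E where "E n = {\<omega> \<in> space M. norm (X \<omega>) > u n \<and> Z \<omega> $ j > v n}" for n
  define Y where "Y n \<omega> = u n *\<^sub>R (X \<omega> /\<^sub>R norm (X \<omega>) - e)" for n \<omega>
  define R where "R \<omega> = X_minus A j (Z \<omega>)" for \<omega>
  define \<rho> where "\<rho> r = r - (e \<bullet> r) *\<^sub>R e" for r :: "real^'d"
  have a0: "norm a > 0" using A_columns[of j] by (simp add: a_def)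
  have \<kappa>a: "norm a \<le> \<kappa>"
    unfolding \<kappa>_def a_def by (rule norm_column_le_total_weight) fact
  have \<kappa>0: "\<kappa> > 0" using a0 \<kappa>a by linarith
  have b1: "b \<ge> 1" using a0 \<kappa>a by (simp add: b_def)
  have e1: "norm e = 1" using a0 by (simp add: e_def direction_def a_def)
  have v_lim: "filterlim v at_top sequentially"
    unfolding v_def using u_lim \<kappa>0
    by (simp add: divide_inverse filterlim_at_top_mult_tendsto_pos[OF tendsto_const])
  have Z_meas[measurable]: "Z \<in> borel_measurable M" and W_meas[measurable]: "W \<in> borel_measurable M"
    using W_indep by (auto simp: independent_rvs_def)
  have Zj[measurable]: "(\<lambda>\<omega>. Z \<omega> $ j) \<in> borel_measurable M"
    using Z_indep by (auto simp: indep_vars_def)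
  have R_meas[measurable]: "R \<in> borel_measurable M"
    unfolding R_def[abs_def] by measurable
  have X_eq: "X \<omega> = (Z \<omega> $ j) *\<^sub>R a + R \<omega>" for \<omega>
    by (simp add: X_def R_def a_def mult_vec_eq_column_plus_X_minus[of A _ j])
  have X_meas[measurable]: "X \<in> borel_measurable M"
    unfolding X_eq[abs_def] by measurable
  have Y_meas[measurable]: "Y n \<in> borel_measurable M" for n
    unfolding Y_def[abs_def] by measurable
  have G_meas[measurable]: "G n \<in> sets M" and E_meas[measurable]: "E n \<in> sets M" for n
    unfolding G_def E_def by measurable
  have G_pos: "prob (G n) > 0" for n
    unfolding G_def by (rule tail_pos[OF Zj Z_tail \<open>c > 0\<close>])

  \<comment> \<open>Joint laws of the ratio and the remainder\<close>
  define P where "P = distr M borel W"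
  define Q where "Q = distr M borel R"
  interpret P: real_distribution P
    unfolding P_def by (rule real_distribution_distr) simp
  interpret Q: prob_space Q
    unfolding Q_def by (rule prob_space_distr) simp
  interpret PQ: pair_prob_space P Q ..
  have Q_sets[measurable_cong]: "sets Q = sets borel" by (simp add: Q_def)
  have P_tail: "P.prob {x<..} = x powr (-\<alpha>)" if "x \<ge> 1" for x
    using W_pareto[OF that] by (simp add: P_def measure_distr vimage_def Int_def conj_commute)

  define \<mu> where "\<mu> n = distr (uniform_measure M (G n)) borel (\<lambda>\<omega>. Z \<omega> $ j / v n)" for n
  have \<mu>: "real_distribution (\<mu> n)" for n
  proof -
    interpret N: prob_space "uniform_measure M (G n)"
      using G_pos[of n] by (intro prob_space_uniform_measure) (auto simp: emeasure_eq_measure)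
    show ?thesis
      unfolding \<mu>_def by (rule N.real_distribution_distr) simp
  qed
  have \<mu>_P: "weak_conv_m \<mu> P"
    unfolding \<mu>_def G_def
    by (rule excess_weak_conv_pareto[OF Zj Z_tail \<open>c > 0\<close> v_lim P.real_distribution_axioms P_tail])
  have pair_cond: "distr (uniform_measure M (G n)) (borel \<Otimes>\<^sub>M borel) (\<lambda>\<omega>. (Z \<omega> $ j / v n, R \<omega>)) = \<mu> n \<Otimes>\<^sub>M Q" for n
    using distr_pair_conditioned[OF Zj R_meas, of "{v n<..}" "\<lambda>z. z / v n" borel] G_pos[of n]
      factor_indep_X_minus[OF Z_indep, of _ _ j A]
    by (simp add: \<mu>_def Q_def G_def R_def)
  have pair_limit: "distr M (borel \<Otimes>\<^sub>M borel) (\<lambda>\<omega>. (W \<omega>, R \<omega>)) = P \<Otimes>\<^sub>M Q"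
    unfolding P_def Q_def
  proof (rule distr_pair_eq_product)
    fix B :: "real set" and C :: "(real^'d) set" assume BC: "B \<in> sets borel" "C \<in> sets borel"
    \<comment> \<open>Independence of \<open>W\<close> and \<open>Z\<close> passes to
      \<open>R\<close>, a Borel function of \<open>Z\<close>.\<close>
    have "X_minus A j -` C \<in> sets borel"
      using measurable_sets[OF borel_measurable_X_minus BC(2)] by simp
    from independent_rvs_prob[OF prob_space_axioms W_indep BC(1) this]
    show "prob {\<omega> \<in> space M. W \<omega> \<in> B \<and> R \<omega> \<in> C} =
        prob {\<omega> \<in> space M. W \<omega> \<in> B} * prob {\<omega> \<in> space M. R \<omega> \<in> C}"
      by (simp add: R_def)
  qed simp_all

  \<comment> \<open>Limit of integrals over \<open>E n\<close> relative to
    \<open>G n\<close>\<close>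
  have S_meas: "(\<lambda>\<omega>. (1 / ((norm (column j A))\<^sup>2 * W \<omega>)) *\<^sub>R S_star A j (Z \<omega>)) \<in> borel_measurable M"
    unfolding scaled_S_star_eq[OF A_columns] R_def[symmetric] by measurable

  \<comment> \<open>Dividing by \<open>prob (G n)\<close> instead of \<open>prob (E n)\<close> makes
    one statement serve twice: for a test function and, with the constant 1, for the
    normalisation.\<close>
  have core: "(\<lambda>n. (\<integral>\<omega>. indicator (E n) \<omega> * f (Y n \<omega>) \<partial>M) / prob (G n)) \<longlonglongrightarrow> b powr (-\<alpha>) * integral\<^sup>L ?\<nu> f"
    if f_cont: "continuous_on UNIV f" and f_bdd: "bounded (range f)" for f :: "real^'d \<Rightarrow> real"
  proof -
    have f_meas[measurable]: "f \<in> borel_measurable borel"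
      by (rule borel_measurable_continuous_onI[OF f_cont])
    obtain B where B: "\<And>x. \<bar>f x\<bar> \<le> B" "B \<ge> 0"
      using bounded_range_abs_le[OF f_bdd] by blast
    \<comment> \<open>Here \<open>x n\<close> rebuilds \<open>X\<close> from the pair
      \<open>(Z $ j / v n, R)\<close>, \<open>h n\<close> is the integrand in these coordinates, and
      \<open>h0\<close> its pointwise limit.\<close>
    define x where "x n p = (v n * fst p) *\<^sub>R a + snd p" for n and p :: "real \<times> (real^'d)"
    define h where "h n p = indicator {u n<..} (norm (x n p)) * f (u n *\<^sub>R (x n p /\<^sub>R norm (x n p) - e))" for n p
    define h0 where "h0 p = indicator {b<..} (fst p) * f ((1 / (fst p / b)) *\<^sub>R \<rho> (snd p))" for p :: "real \<times> (real^'d)"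
    have [measurable]: "\<rho> \<in> borel_measurable borel"
      unfolding \<rho>_def[abs_def] by measurable
    have x_meas[measurable]: "x n \<in> borel_measurable (borel \<Otimes>\<^sub>M borel)" for n
      unfolding x_def[abs_def] by measurable
    have h_meas[measurable]: "h n \<in> borel_measurable (borel \<Otimes>\<^sub>M borel)" for n
      unfolding h_def[abs_def] by measurable
    have h0_meas[measurable]: "h0 \<in> borel_measurable (borel \<Otimes>\<^sub>M borel)"
      unfolding h0_def[abs_def] by measurable
    have "(\<lambda>n. integral\<^sup>L (\<mu> n \<Otimes>\<^sub>M Q) (h n)) \<longlonglongrightarrow> integral\<^sup>L (P \<Otimes>\<^sub>M Q) h0"
    proof (rule integral_pair_tendsto[OF \<mu> P.real_distribution_axioms \<mu>_P Q.prob_space_axioms])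
      show "\<bar>h n p\<bar> \<le> B" for n p
        using B by (auto simp: h_def indicator_def)
      have "AE t in P. t > 1 \<and> t \<noteq> b"
        by (rule P.pareto_AE[OF P_tail])
      then show "AE t in P. \<forall>r\<in>space Q. \<forall>\<tau>. \<tau> \<longlonglongrightarrow> t \<longrightarrow> (\<lambda>n. h n (\<tau> n, r)) \<longlonglongrightarrow> h0 (t, r)"
      proof eventually_elim
        case (elim t)
        show ?case
        proof (intro ballI allI impI)
          fix r :: "real^'d" and \<tau> :: "nat \<Rightarrow> real" assume \<tau>: "\<tau> \<longlonglongrightarrow> t"
          \<comment> \<open>The length along \<open>e\<close>: since
            \<open>norm a / \<kappa> = 1 / b\<close>, the quotient \<open>s n / u n\<close> is
            \<open>\<tau> n / b\<close>, with limit \<open>t / b\<close>.\<close>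
          define s where "s n = v n * \<tau> n * norm a" for n
          have xs: "x n (\<tau> n, r) = s n *\<^sub>R e + r" for n
            by (simp add: x_def s_def e_def direction_def a_def A_columns)
          have upos: "eventually (\<lambda>n. u n > 0) sequentially"
            using u_lim by (simp add: filterlim_at_top_dense)
          have "(\<lambda>n. \<tau> n / b) \<longlonglongrightarrow> t / b"
            by (intro tendsto_intros \<tau>) (use b1 in auto)
          moreover have "eventually (\<lambda>n. \<tau> n / b = s n / u n) sequentially"
            using upos by eventually_elim (use a0 \<kappa>0 in \<open>simp add: s_def v_def b_def\<close>)
          ultimately have s: "(\<lambda>n. s n / u n) \<longlonglongrightarrow> t / b"
            by (rule Lim_transform_eventually)
          have tb: "t / b > 0" using elim b1 by simp
          note lim = tendsto_perturbed_direction[OF e1 u_lim s tb, of r]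
          have f_lim: "(\<lambda>n. f (u n *\<^sub>R (x n (\<tau> n, r) /\<^sub>R norm (x n (\<tau> n, r)) - e))) \<longlonglongrightarrow> f ((1 / (t / b)) *\<^sub>R \<rho> r)"
            unfolding xs \<rho>_def
            by (rule continuous_on_tendsto_compose[OF f_cont lim(2)]) auto
          \<comment> \<open>The norm divided by \<open>u n\<close> tends to \<open>t / b\<close>,
            which differs from 1 as \<open>t \<noteq> b\<close>; the indicator is therefore
            eventually constant.\<close>
          have "eventually (\<lambda>n. indicator {b<..} t = (indicator {u n<..} (norm (x n (\<tau> n, r))) :: real)) sequentially"
          proof (cases "t > b")
            case True
            then have "t / b > 1" using b1 by simp
            from upos order_tendstoD(1)[OF lim(1) this] show ?thesis
              by eventually_elim (use True in \<open>simp add: xs\<close>)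
          next
            case False
            then have "t / b < 1" using b1 elim by simp
            from upos order_tendstoD(2)[OF lim(1) this] show ?thesis
              by eventually_elim (use False in \<open>simp add: xs\<close>)
          qed
          then have "(\<lambda>n. indicator {u n<..} (norm (x n (\<tau> n, r))) :: real) \<longlonglongrightarrow> indicator {b<..} t"
            by (rule Lim_transform_eventually[OF tendsto_const])
          then show "(\<lambda>n. h n (\<tau> n, r)) \<longlonglongrightarrow> h0 (t, r)"
            unfolding h_def h0_def fst_conv snd_conv by (intro tendsto_mult f_lim)
        qed
      qed
    qed measurable
    moreover have "eventually (\<lambda>n. integral\<^sup>L (\<mu> n \<Otimes>\<^sub>M Q) (h n) =
        (\<integral>\<omega>. indicator (E n) \<omega> * f (Y n \<omega>) \<partial>M) / prob (G n)) sequentially"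
    proof -
      have "eventually (\<lambda>n. v n > 0) sequentially"
        using v_lim by (simp add: filterlim_at_top_dense)
      then show ?thesis
      proof eventually_elim
        case (elim n)
        have "integral\<^sup>L (\<mu> n \<Otimes>\<^sub>M Q) (h n) = (\<integral>\<omega>. h n (Z \<omega> $ j / v n, R \<omega>) \<partial>uniform_measure M (G n))"
          unfolding pair_cond[symmetric] by (rule integral_distr) measurable
        also have "\<dots> = (\<integral>\<omega>. indicator (G n) \<omega> * h n (Z \<omega> $ j / v n, R \<omega>) \<partial>M) / prob (G n)"
          by (rule integral_uniform_measure[OF G_meas G_pos]) measurable
        \<comment> \<open>On actual outcomes \<open>x n\<close> returns \<open>X \<omega>\<close>,
          as \<open>v n\<close> cancels, and the two indicators multiply to that of
          \<open>E n\<close>.\<close>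
        also have "(\<integral>\<omega>. indicator (G n) \<omega> * h n (Z \<omega> $ j / v n, R \<omega>) \<partial>M) =
            (\<integral>\<omega>. indicator (E n) \<omega> * f (Y n \<omega>) \<partial>M)"
        proof (rule Bochner_Integration.integral_cong)
          fix \<omega> assume "\<omega> \<in> space M"
          moreover have "x n (Z \<omega> $ j / v n, R \<omega>) = X \<omega>"
            using elim by (simp add: x_def X_eq)
          ultimately show "indicator (G n) \<omega> * h n (Z \<omega> $ j / v n, R \<omega>) = indicator (E n) \<omega> * f (Y n \<omega>)"
            by (auto simp: h_def Y_def G_def E_def indicator_def)
        qed simp
        finally show ?case .
      qed
    qed
    ultimately have "(\<lambda>n. (\<integral>\<omega>. indicator (E n) \<omega> * f (Y n \<omega>) \<partial>M) / prob (G n)) \<longlonglongrightarrow> integral\<^sup>L (P \<Otimes>\<^sub>M Q) h0"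
      by (rule Lim_transform_eventually)
    also have "integral\<^sup>L (P \<Otimes>\<^sub>M Q) h0 = b powr (-\<alpha>) * integral\<^sup>L ?\<nu> f"
    proof -
      \<comment> \<open>\<open>h0 (t, r)\<close> is \<open>k (t / b, r)\<close> restricted to
        \<open>t > b\<close>. Integrating over \<open>r\<close> first leaves a function of
        \<open>t / b\<close>, to which the Pareto rescaling applies; \<open>b\<close> survives only
        in the factor \<open>b powr (-\<alpha>)\<close>.\<close>
      define k where "k p = f ((1 / fst p) *\<^sub>R \<rho> (snd p))" for p :: "real \<times> (real^'d)"
      have k_meas[measurable]: "k \<in> borel_measurable (borel \<Otimes>\<^sub>M borel)"
        unfolding k_def[abs_def] by measurable
      define g where "g t = (\<integral>r. k (t, r) \<partial>Q)" for t
      have g_meas: "g \<in> borel_measurable borel"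
        unfolding g_def[abs_def] by measurable
      have h0_int: "integrable (P \<Otimes>\<^sub>M Q) h0"
        by (rule PQ.integrable_const_bound[where B = B])
           (use B in \<open>auto simp: h0_def indicator_def\<close>)
      have k_int: "integrable (P \<Otimes>\<^sub>M Q) k"
        by (rule PQ.integrable_const_bound[where B = B]) (use B in \<open>auto simp: k_def\<close>)
      have "integral\<^sup>L (P \<Otimes>\<^sub>M Q) h0 = (\<integral>t. (\<integral>r. h0 (t, r) \<partial>Q) \<partial>P)"
        by (rule PQ.integral_fst'[OF h0_int, symmetric])
      also have "\<dots> = (\<integral>t. indicator {b<..} t * g (t / b) \<partial>P)"
        by (simp add: h0_def g_def k_def)
      also have "\<dots> = b powr (-\<alpha>) * integral\<^sup>L P g"
        by (rule P.pareto_integral_rescale[OF P_tail b1 g_meas])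
      also have "integral\<^sup>L P g = integral\<^sup>L (P \<Otimes>\<^sub>M Q) k"
        unfolding g_def by (rule PQ.integral_fst'[OF k_int])
      also have "\<dots> = (\<integral>\<omega>. k (W \<omega>, R \<omega>) \<partial>M)"
        unfolding pair_limit[symmetric] by (rule integral_distr) measurable
      also have "(\<lambda>\<omega>. k (W \<omega>, R \<omega>)) = (\<lambda>\<omega>. f ((1 / ((norm (column j A))\<^sup>2 * W \<omega>)) *\<^sub>R S_star A j (Z \<omega>)))"
        by (simp add: scaled_S_star_eq[OF A_columns] k_def \<rho>_def e_def R_def)
      also have "integral\<^sup>L M \<dots> = integral\<^sup>L ?\<nu> f"
        by (rule integral_distr[symmetric, OF S_meas f_meas])
      finally show ?thesis .
    qed
    finally show ?thesis .
  qed

  \<comment> \<open>Passage from \<open>G n\<close> to \<open>E n\<close>\<close>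
  have \<nu>_1: "integral\<^sup>L ?\<nu> (\<lambda>_. 1) = (1 :: real)"
  proof -
    interpret \<nu>: prob_space ?\<nu> by (rule prob_space_distr[OF S_meas])
    show ?thesis using \<nu>.prob_space by simp
  qed
  have b_pos: "b powr (-\<alpha>) > 0" using b1 by simp
  \<comment> \<open>The limit is the Pareto probability of exceeding \<open>b\<close>. Being
    positive, it can divide and it makes \<open>prob (E n)\<close> eventually positive, so that the
    conditional law is a genuine one.\<close>
  have E_G: "(\<lambda>n. prob (E n) / prob (G n)) \<longlonglongrightarrow> b powr (-\<alpha>)"
    using core[of "\<lambda>_. 1"] \<nu>_1 by simp
  show ?thesis
    unfolding converges_weakly_def
  proof (intro allI impI, elim conjE)
    fix f :: "real^'d \<Rightarrow> real" assume f: "continuous_on UNIV f" "bounded (range f)"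
    have f_meas[measurable]: "f \<in> borel_measurable borel"
      by (rule borel_measurable_continuous_onI[OF f(1)])
    let ?I = "\<lambda>n. \<integral>\<omega>. indicator (E n) \<omega> * f (Y n \<omega>) \<partial>M"
    \<comment> \<open>The factor \<open>prob (G n)\<close> cancels in the quotient, and
      \<open>b powr (-\<alpha>)\<close> cancels in its limit.\<close>
    have "(\<lambda>n. (?I n / prob (G n)) / (prob (E n) / prob (G n))) \<longlonglongrightarrow>
        (b powr (-\<alpha>) * integral\<^sup>L ?\<nu> f) / b powr (-\<alpha>)"
      by (intro tendsto_divide core[OF f] E_G) (use b_pos in auto)
    moreover have "eventually (\<lambda>n. (?I n / prob (G n)) / (prob (E n) / prob (G n)) =
        integral\<^sup>L (?\<mu> n) f) sequentially"
      using order_tendstoD(1)[OF E_G b_pos]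
    proof eventually_elim
      case (elim n)
      then have E_pos: "prob (E n) > 0"
        using G_pos[of n] by (simp add: zero_less_divide_iff)
      have "integral\<^sup>L (?\<mu> n) f = integral\<^sup>L (distr (uniform_measure M (E n)) borel (Y n)) f"
        by (simp add: cond_law_def E_def Y_def[abs_def] v_def \<kappa>_def e_def)
      also have "\<dots> = (\<integral>\<omega>. f (Y n \<omega>) \<partial>uniform_measure M (E n))"
        by (rule integral_distr) measurable
      also have "\<dots> = ?I n / prob (E n)"
        by (rule integral_uniform_measure[OF E_meas E_pos]) measurable
      finally show ?case
        using G_pos[of n] by simp
    qed
    ultimately show "(\<lambda>n. integral\<^sup>L (?\<mu> n) f) \<longlonglongrightarrow> integral\<^sup>L ?\<nu> f"
      using b_pos by (auto intro: Lim_transform_eventually)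
  qed
qed

end
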